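(* Let $H=(V,E)$ be a finite bipartite graph with no isolated vertices. If $H$ is not a star graph, then \[\min_{e\in E(H)}|S_1(e)|\le |E(H)|-\frac{|V(H)|}{2},\] and equality holds if and only if $H$ is isomorphic to one of: $K_{2,2}$; $H_n^1$ for some $n\ge2$; $H_n^2$ for some even $n\ge 2$; $H_n^3$ for some even $n\ge2$; $H_n^4$ for some odd $n\ge3$.
   Context: For an edge $e$ of a graph, $S_1(e)$ denotes the set of edges different from $e$ that share an endpoint with $e$ (so $|S_1(u\sim v)|=d_u+d_v-2$). A star graph is $K_{1,m}$ for some $m\ge1$ (including $K_{1,1}$). The graphs: $H_n^1$ ($n\ge1$) is the disjoint union of $n$ edges (a perfect matching on $2n$ vertices). $H_n^2$ ($n$ even) is the disjoint union of two copies of $K_{1,n/2}$, with bipartition in which both centers lie in one part (sizes $2$ and $n$). $H_n^3$ ($n$ even) is the disjoint union of two copies of $K_{1,n/2}$, with bipartition in which one center lies in each part (both parts of size $n/2+1$). $H_n^4$ ($n$ odd, $n\ge3$), with $k=\frac{n+1}{2}$, has bipartition $A=\{u_1,\dots,u_k\}$, $B=\{v_1,\dots,v_k\}$ and edge set $\{u_1v_j:1\le j\le k\}\cup\{u_iv_k:1\le i\le k\}$ (a tree with $n$ edges). *)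

theory Defs
  imports Complex_Main
begin

text \<open>A graph is given by its vertex set and its set of edges, the edges being two-element sets of
  vertices. A bipartite graph together with a bipartition is a triple (A, B, E) of the two parts
  and the edge set.\<close>

type_synonym 'a bigraph = "'a set \<times> 'a set \<times> 'a set set"

definition simple_graph :: "'a set \<Rightarrow> 'a set set \<Rightarrow> bool" where
  "simple_graph V E \<longleftrightarrow> (\<forall>e\<in>E. e \<subseteq> V \<and> card e = 2)"

definition bipartition :: "'a set \<Rightarrow> 'a set set \<Rightarrow> 'a set \<Rightarrow> 'a set \<Rightarrow> bool" where
  "bipartition V E A B \<longleftrightarrow>
     A \<union> B = V \<and> A \<inter> B = {} \<and> (\<forall>e\<in>E. \<exists>a\<in>A. \<exists>b\<in>B. e = {a, b})"

definition no_isolated_vertices :: "'a set \<Rightarrow> 'a set set \<Rightarrow> bool" where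
  "no_isolated_vertices V E \<longleftrightarrow> (\<forall>v\<in>V. \<exists>e\<in>E. v \<in> e)"

definition S1 :: "'a set set \<Rightarrow> 'a set \<Rightarrow> 'a set set" where
  "S1 E e = {e' \<in> E. e' \<noteq> e \<and> e' \<inter> e \<noteq> {}}"

definition graph_iso :: "'a set \<Rightarrow> 'a set set \<Rightarrow> 'b set \<Rightarrow> 'b set set \<Rightarrow> bool" where
  "graph_iso V E V' E' \<longleftrightarrow> (\<exists>f. bij_betw f V V' \<and> (\<lambda>e. f ` e) ` E = E')"

text \<open>Isomorphisms of bipartite graphs carry the bipartition to the bipartition. The two parts are
  not ordered, so they may be interchanged.\<close>

definition bigraph_iso :: "'a bigraph \<Rightarrow> 'b bigraph \<Rightarrow> bool" where
  "bigraph_iso = (\<lambda>(A, B, E) (A', B', E').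
     \<exists>f. bij_betw f (A \<union> B) (A' \<union> B') \<and> (\<lambda>e. f ` e) ` E = E' \<and>
         (f ` A = A' \<and> f ` B = B' \<or> f ` A = B' \<and> f ` B = A'))"

definition complete_bipartite :: "nat \<Rightarrow> nat \<Rightarrow> (nat + nat) bigraph" where
  "complete_bipartite s t =
     (Inl ` {1..s}, Inr ` {1..t}, {{Inl i, Inr j} |i j. i \<in> {1..s} \<and> j \<in> {1..t}})"

definition star_graph :: "'a set \<Rightarrow> 'a set set \<Rightarrow> bool" where
  "star_graph V E \<longleftrightarrow>
     (\<exists>m\<ge>1. case complete_bipartite 1 m of (A', B', E') \<Rightarrow> graph_iso V E (A' \<union> B') E')"

definition swap_parts :: "'a bigraph \<Rightarrow> 'a bigraph" where
  "swap_parts = (\<lambda>(A, B, E). (B, A, E))"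

definition disjoint_union :: "'a bigraph \<Rightarrow> 'b bigraph \<Rightarrow> ('a + 'b) bigraph" where
  "disjoint_union = (\<lambda>(A, B, E) (A', B', E').
     (Inl ` A \<union> Inr ` A', Inl ` B \<union> Inr ` B',
      (\<lambda>e. Inl ` e) ` E \<union> (\<lambda>e. Inr ` e) ` E'))"

definition H1 :: "nat \<Rightarrow> (nat + nat) bigraph" where
  "H1 n = (Inl ` {1..n}, Inr ` {1..n}, {{Inl i, Inr i} |i. i \<in> {1..n}})"

text \<open>The part of \<open>complete_bipartite 1 m\<close> listed first consists of the centre. Hence the two
  centres lie in the same part of \<open>H2 n\<close> and in different parts of \<open>H3 n\<close>; forgetting the
  bipartitions, the two graphs are the same. Both are meant for even \<open>n\<close>.\<close>

definition H2 :: "nat \<Rightarrow> ((nat + nat) + (nat + nat)) bigraph" where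
  "H2 n = disjoint_union (complete_bipartite 1 (n div 2)) (complete_bipartite 1 (n div 2))"

definition H3 :: "nat \<Rightarrow> ((nat + nat) + (nat + nat)) bigraph" where
  "H3 n = disjoint_union (complete_bipartite 1 (n div 2))
            (swap_parts (complete_bipartite 1 (n div 2)))"

text \<open>Meant for odd \<open>n\<close>, with \<open>Inl i\<close> for $u_i$ and \<open>Inr j\<close> for $v_j$.\<close>

definition H4 :: "nat \<Rightarrow> (nat + nat) bigraph" where
  "H4 n = (let k = (n + 1) div 2 in
     (Inl ` {1..k}, Inr ` {1..k},
      {{Inl 1, Inr j} |j. j \<in> {1..k}} \<union> {{Inl i, Inr k} |i. i \<in> {1..k}}))"

end

theory Submission
  imports Defs
begin

text \<open>Write \<open>m\<close> and \<open>N\<close> for the numbers of edges and vertices and \<open>s\<close> for the minimum of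
  $|S_1(e)|$, so that $d_u + d_v \ge s + 2$ for every edge $uv$. Summing $1/d_u + 1/d_v$ over all
  edges gives \<open>N\<close>, and since $d_u d_v \ge d_u + d_v - 1$ every summand is at most $(s+2)/(s+1)$.
  This settles the case $m \ge 2s+2$; equality forces every edge to have a leaf, and
  $m = 2s + 2$ unless \<open>s = 0\<close>, which gives two stars of equal size or a perfect matching.

  If $m \le 2s+1$, then counting the edges which touch one of two disjoint edges shows that any two
  disjoint edges are linked by a third one, and that $m \ge 2s$. Linkedness allows one to assign
  distinct further edges to the vertices outside a fixed edge, whence $N \le m + 1$, with one less
  for every 4-cycle through the fixed edge. Two disjoint edges lie on a 4-cycle when $m = 2s$, so
  $N \le m$ in that case. Equality leaves a balanced double star for $m = 2s + 1$ and a single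
  4-cycle for $m = 2s$.\<close>

section \<open>Relations as bipartite graphs\<close>

definition deg :: "('a \<times> 'b) set \<Rightarrow> 'a \<Rightarrow> nat" where
  "deg R x = card (R `` {x})"

lemma deg_pos:
  assumes "finite R" "(x, y) \<in> R"
  shows "1 \<le> deg R x"
proof -
  have "R `` {x} \<noteq> {}" "finite (R `` {x})" using assms by (auto simp: finite_Image)
  then show ?thesis unfolding deg_def by (simp add: Suc_le_eq card_gt_0_iff)
qed

lemma deg_converse_pos:
  assumes "finite R" "(x, y) \<in> R"
  shows "1 \<le> deg (R\<inverse>) y"
  using assms by (intro deg_pos) auto

lemma deg_ge_card:
  assumes "finite R" "{x} \<times> P \<subseteq> R"
  shows "card P \<le> deg R x"
  unfolding deg_def by (rule card_mono) (use assms in \<open>auto simp: finite_Image\<close>)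

lemma deg_eq_oneD:
  assumes "deg R x = 1" "(x, y) \<in> R" "(x, z) \<in> R"
  shows "y = z"
proof -
  obtain u where "R `` {x} = {u}" using assms(1) by (auto simp: deg_def card_1_singleton_iff)
  moreover have "y \<in> R `` {x}" "z \<in> R `` {x}" using assms(2,3) by auto
  ultimately show ?thesis by simp
qed

lemma sum_inverse_deg:
  assumes "finite R"
  shows "(\<Sum>(x, y)\<in>R. 1 / real (deg R x)) = card (Domain R)"
proof -
  have "(\<Sum>(x, y)\<in>R. 1 / real (deg R x)) =
      (\<Sum>(x, y)\<in>Sigma (Domain R) (\<lambda>x. R `` {x}). 1 / real (deg R x))"
    by (rule sum.cong) auto
  also have "\<dots> = (\<Sum>x\<in>Domain R. \<Sum>y\<in>R `` {x}. 1 / real (deg R x))"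
    using assms by (subst sum.Sigma) (auto simp: finite_Domain finite_Image)
  also have "\<dots> = (\<Sum>x\<in>Domain R. 1)"
  proof (rule sum.cong)
    fix x assume "x \<in> Domain R"
    then obtain y where "(x, y) \<in> R" by auto
    from deg_pos[OF assms this] show "(\<Sum>y\<in>R `` {x}. 1 / real (deg R x)) = 1"
      by (simp add: deg_def)
  qed simp
  finally show ?thesis by simp
qed

lemma sum_inverse_deg_converse:
  assumes "finite R"
  shows "(\<Sum>(x, y)\<in>R. 1 / real (deg (R\<inverse>) y)) = card (Range R)"
proof -
  have "(\<Sum>(x, y)\<in>R. 1 / real (deg (R\<inverse>) y)) = (\<Sum>(y, x)\<in>R\<inverse>. 1 / real (deg (R\<inverse>) y))"
    by (rule sum.reindex_bij_witness[of _ "\<lambda>(x, y). (y, x)" "\<lambda>(x, y). (y, x)"]) auto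
  with sum_inverse_deg[of "R\<inverse>"] assms show ?thesis by simp
qed

lemma inverse_sum_bound:
  fixes x y s :: nat
  assumes "1 \<le> x" "1 \<le> y" "s + 2 \<le> x + y"
  shows "1 / real x + 1 / real y \<le> (real s + 2) / (real s + 1)"
    and "1 / real x + 1 / real y = (real s + 2) / (real s + 1) \<Longrightarrow>
      x = 1 \<and> y = s + 1 \<or> y = 1 \<and> x = s + 1"
proof -
  have pos: "real x > 0" "real y > 0" using assms by auto
  have key: "(real s + 2) * (real x * real y) - (real s + 1) * (real x + real y) =
      (real s + 2) * ((real x - 1) * (real y - 1)) + (real x + real y - (real s + 2))"
    by (simp add: algebra_simps)
  have n1: "(real s + 2) * ((real x - 1) * (real y - 1)) \<ge> 0" using assms by simp
  have n2: "real x + real y - (real s + 2) \<ge> 0" using assms by linarith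
  have eq: "1 / real x + 1 / real y = (real x + real y) / (real x * real y)"
    using pos by (simp add: field_simps)
  have "(real s + 1) * (real x + real y) \<le> (real s + 2) * (real x * real y)"
    using key n1 n2 by linarith
  then show "1 / real x + 1 / real y \<le> (real s + 2) / (real s + 1)"
    unfolding eq using pos by (simp add: divide_le_eq le_divide_eq mult.commute)
  assume "1 / real x + 1 / real y = (real s + 2) / (real s + 1)"
  then have "(real s + 1) * (real x + real y) = (real s + 2) * (real x * real y)"
    unfolding eq using pos by (simp add: divide_eq_eq eq_divide_eq mult.commute)
  then have "(real s + 2) * ((real x - 1) * (real y - 1)) = 0" "real x + real y - (real s + 2) = 0"
    using key n1 n2 by linarith+
  then have "x = 1 \<or> y = 1" "real x + real y = real (s + 2)" by auto
  then show "x = 1 \<and> y = s + 1 \<or> y = 1 \<and> x = s + 1" by auto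
qed

lemma many_edges_bound:
  fixes R :: "('a \<times> 'b) set"
  assumes fin: "finite R"
    and s: "\<And>x y. (x, y) \<in> R \<Longrightarrow> s + 2 \<le> deg R x + deg (R\<inverse>) y"
    and m: "2 * s + 2 \<le> card R \<or> s = 0"
  shows "2 * s + card (Domain R) + card (Range R) \<le> 2 * card R"
    and "2 * s + card (Domain R) + card (Range R) = 2 * card R \<Longrightarrow> (x, y) \<in> R \<Longrightarrow>
      deg R x = 1 \<and> deg (R\<inverse>) y = s + 1 \<or> deg (R\<inverse>) y = 1 \<and> deg R x = s + 1"
    and "2 * s + card (Domain R) + card (Range R) = 2 * card R \<Longrightarrow> s = 0 \<or> card R = 2 * s + 2"
proof -
  let ?w = "\<lambda>(x, y). 1 / real (deg R x) + 1 / real (deg (R\<inverse>) y)"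
  define c where "c = (real s + 2) / (real s + 1)"
  have N: "sum ?w R = real (card (Domain R) + card (Range R))"
    using sum_inverse_deg[OF fin] sum_inverse_deg_converse[OF fin]
    by (simp add: case_prod_unfold sum.distrib)
  have w: "?w e \<le> c" if "e \<in> R" for e
    using that inverse_sum_bound(1)[OF deg_pos[OF fin] deg_converse_pos[OF fin] s]
    unfolding c_def by (cases e) auto
  have sc: "(real s + 1) * (real (card R) * c) = real (card R) * (real s + 2)"
    by (simp add: c_def field_simps)
  have le: "sum ?w R \<le> real (card R) * c"
    using sum_mono[of R ?w "\<lambda>_. c", OF w] by simp
  have "real s * (2 * real s + 2) \<le> real s * real (card R)"
    using m by (cases "s = 0") (auto intro!: mult_left_mono)
  then have "(real s + 1) * (2 * real s) \<le> (real s + 1) * (2 * real (card R) - real (card R) * c)"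
    unfolding right_diff_distrib[of "real s + 1"] sc by (simp add: algebra_simps)
  then have le2: "2 * real s \<le> 2 * real (card R) - real (card R) * c"
    by (subst (asm) mult_le_cancel_left_pos) auto
  show "2 * s + card (Domain R) + card (Range R) \<le> 2 * card R"
    using N le le2 by linarith
  assume eq: "2 * s + card (Domain R) + card (Range R) = 2 * card R"
  have e1: "sum ?w R = (\<Sum>e\<in>R. c)" and e2: "2 * real s = 2 * real (card R) - real (card R) * c"
    using N le le2 arg_cong[OF eq, of real] by simp_all
  have "(real s + 1) * (2 * real s) = (real s + 1) * (2 * real (card R)) - real (card R) * (real s + 2)"
    unfolding e2 right_diff_distrib[of "real s + 1"] sc by simp
  then have "real s * (real (card R) - real (2 * s + 2)) = 0" by (simp add: algebra_simps)
  then show "s = 0 \<or> card R = 2 * s + 2" by (metis eq_iff_diff_eq_0 mult_eq_0_iff of_nat_eq_0_iff of_nat_eq_iff)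
  assume xy: "(x, y) \<in> R"
  have "?w (x, y) = c"
    using sum_mono_inv[OF e1 w xy fin] by simp
  then show "deg R x = 1 \<and> deg (R\<inverse>) y = s + 1 \<or> deg (R\<inverse>) y = 1 \<and> deg R x = s + 1"
    using inverse_sum_bound(2)[OF deg_pos[OF fin xy] deg_converse_pos[OF fin xy] s[OF xy]]
    unfolding c_def by simp
qed

lemma card_edges_touching:
  fixes R :: "('a \<times> 'b) set"
  assumes fin: "finite R" and e: "(a, b) \<in> R" "(a', b') \<in> R" "a \<noteq> a'" "b \<noteq> b'"
  shows "card {(x, y) \<in> R. x \<in> {a, a'} \<or> y \<in> {b, b'}} + card (R \<inter> {(a, b'), (a', b)}) + 2 =
    deg R a + deg (R\<inverse>) b + (deg R a' + deg (R\<inverse>) b')"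
proof -
  define X where "X = {(x, y) \<in> R. x \<in> {a, a'}}"
  define Y where "Y = {(x, y) \<in> R. y \<in> {b, b'}}"
  have fX: "finite X" "finite Y"
    by (rule finite_subset[OF _ fin], auto simp: X_def Y_def)+
  have cX: "card X = deg R a + deg R a'"
  proof -
    have "X = Pair a ` (R `` {a}) \<union> Pair a' ` (R `` {a'})" by (auto simp: X_def)
    moreover have "Pair a ` (R `` {a}) \<inter> Pair a' ` (R `` {a'}) = {}" using e by auto
    ultimately show ?thesis using fin
      by (simp add: card_Un_disjoint deg_def card_image inj_on_def finite_Image)
  qed
  have cY: "card Y = deg (R\<inverse>) b + deg (R\<inverse>) b'"
  proof -
    have "Y = (\<lambda>x. (x, b)) ` (R\<inverse> `` {b}) \<union> (\<lambda>x. (x, b')) ` (R\<inverse> `` {b'})"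
      by (auto simp: Y_def)
    moreover have "((\<lambda>x. (x, b)) ` (R\<inverse> `` {b})) \<inter> ((\<lambda>x. (x, b')) ` (R\<inverse> `` {b'})) = {}"
      using e by auto
    ultimately show ?thesis using fin
      by (simp add: card_Un_disjoint deg_def card_image inj_on_def finite_Image)
  qed
  have "X \<inter> Y = insert (a, b) (insert (a', b') (R \<inter> {(a, b'), (a', b)}))"
    using e by (auto simp: X_def Y_def)
  then have "card (X \<inter> Y) = card (R \<inter> {(a, b'), (a', b)}) + 2" using e by simp
  moreover have "{(x, y) \<in> R. x \<in> {a, a'} \<or> y \<in> {b, b'}} = X \<union> Y" by (auto simp: X_def Y_def)
  ultimately show ?thesis using card_Un_Int[OF fX] cX cY by simp
qed

lemma vertices_plus_squares_le:
  fixes R :: "('a \<times> 'b) set"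
  assumes fin: "finite R" and e: "(a, b) \<in> R"
    and linked: "\<And>x y. (x, y) \<in> R \<Longrightarrow> x \<noteq> a \<Longrightarrow> y \<noteq> b \<Longrightarrow> (a, y) \<in> R \<or> (x, b) \<in> R"
  shows "card (Domain R) + card (Range R) +
    card {(x, y) \<in> R. x \<noteq> a \<and> y \<noteq> b \<and> (a, y) \<in> R \<and> (x, b) \<in> R} \<le> card R + 1"
proof -
  define Q where "Q = {(x, y) \<in> R. x \<noteq> a \<and> y \<noteq> b \<and> (a, y) \<in> R \<and> (x, b) \<in> R}"
  \<comment> \<open>A vertex other than \<open>a\<close>, \<open>b\<close> is sent to an edge joining it to \<open>(a, b)\<close> if there is one, and
    to an arbitrary edge at that vertex otherwise.\<close>
  define p where "p x = (if (x, b) \<in> R then b else SOME y. (x, y) \<in> R)" for x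
  define q where "q y = (if (a, y) \<in> R then a else SOME x. (x, y) \<in> R)" for y
  define X where "X = (\<lambda>x. (x, p x)) ` (Domain R - {a})"
  define Y where "Y = (\<lambda>y. (q y, y)) ` (Range R - {b})"
  have p: "(x, p x) \<in> R" if "x \<in> Domain R" for x
    using that unfolding p_def by (auto intro: someI)
  have q: "(q y, y) \<in> R" if "y \<in> Range R" for y
    using that unfolding q_def by (auto intro: someI)
  have XR: "X \<subseteq> R" "Y \<subseteq> R" "Q \<subseteq> R" using p q by (auto simp: X_def Y_def Q_def)
  have X: "x \<noteq> a \<and> (y = b \<or> (x, b) \<notin> R)" if "(x, y) \<in> X" for x y
    using that by (auto simp: X_def p_def split: if_splits)
  have Y: "y \<noteq> b \<and> (x = a \<or> (a, y) \<notin> R)" if "(x, y) \<in> Y" for x y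
    using that by (auto simp: Y_def q_def split: if_splits)
  have fins: "finite X" "finite Y" "finite Q" using XR fin finite_subset by blast+
  have d1: "X \<inter> Y = {}"
  proof (rule ccontr)
    assume "X \<inter> Y \<noteq> {}"
    then obtain x y where xy: "(x, y) \<in> X" "(x, y) \<in> Y" by auto
    with XR have "(x, y) \<in> R" by auto
    with X[OF xy(1)] Y[OF xy(2)] linked[of x y] show False by auto
  qed
  have d2: "(X \<union> Y) \<inter> Q = {}" using X Y by (auto simp: Q_def)
  have d3: "(a, b) \<notin> X \<union> Y \<union> Q" using X Y by (auto simp: Q_def)
  have "card (insert (a, b) (X \<union> Y \<union> Q)) \<le> card R"
    by (rule card_mono[OF fin]) (use XR e in auto)
  then have "card X + card Y + card Q + 1 \<le> card R"
    using d1 d2 d3 fins by (simp add: card_Un_disjoint)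
  moreover have "card X = card (Domain R) - 1"
    using e unfolding X_def by (subst card_image) (auto simp: inj_on_def card_Diff_singleton Domain.DomainI)
  moreover have "card Y = card (Range R) - 1"
    using e unfolding Y_def by (subst card_image) (auto simp: inj_on_def card_Diff_singleton Range.intros)
  moreover have "card (Domain R) > 0" "card (Range R) > 0"
    using e fin by (auto simp: card_gt_0_iff finite_Domain finite_Range)
  ultimately show ?thesis unfolding Q_def by linarith
qed

section \<open>Relations with few edges\<close>

lemma few_edges_linked:
  fixes R :: "('a \<times> 'b) set"
  assumes fin: "finite R"
    and s: "\<And>x y. (x, y) \<in> R \<Longrightarrow> s + 2 \<le> deg R x + deg (R\<inverse>) y"
    and e: "(a, b) \<in> R" "(a', b') \<in> R" "a \<noteq> a'" "b \<noteq> b'"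
  shows "2 * s + 2 \<le> card R + card (R \<inter> {(a, b'), (a', b)})"
    and "card R + card (R \<inter> {(a, b'), (a', b)}) = 2 * s + 2 \<Longrightarrow>
      deg R a + deg (R\<inverse>) b = s + 2 \<and> deg R a' + deg (R\<inverse>) b' = s + 2 \<and>
      (\<forall>(x, y) \<in> R. x \<in> {a, a'} \<or> y \<in> {b, b'})"
proof -
  let ?T = "{(x, y) \<in> R. x \<in> {a, a'} \<or> y \<in> {b, b'}}"
  have sub: "?T \<subseteq> R" by auto
  have le: "card ?T \<le> card R" using fin by (rule card_mono) auto
  note T = card_edges_touching[OF fin e] s[OF e(1)] s[OF e(2)]
  show "2 * s + 2 \<le> card R + card (R \<inter> {(a, b'), (a', b)})"
    using T le by linarith
  assume eq: "card R + card (R \<inter> {(a, b'), (a', b)}) = 2 * s + 2"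
  then have "card ?T = card R" using T le by linarith
  then have "?T = R" using card_subset_eq[OF fin sub] by simp
  then show "deg R a + deg (R\<inverse>) b = s + 2 \<and> deg R a' + deg (R\<inverse>) b' = s + 2 \<and>
      (\<forall>(x, y) \<in> R. x \<in> {a, a'} \<or> y \<in> {b, b'})"
    using T le eq by auto
qed

lemma card_links_le: "card (R \<inter> {(a, b'), (a', b)}) \<le> 2"
proof -
  have "card (R \<inter> {(a, b'), (a', b)}) \<le> card {(a, b'), (a', b)}" by (rule card_mono) auto
  also have "\<dots> \<le> 2" by (simp add: card_insert_if)
  finally show ?thesis .
qed

lemma few_edges_bound:
  fixes R :: "('a \<times> 'b) set"
  assumes fin: "finite R"
    and s: "\<And>x y. (x, y) \<in> R \<Longrightarrow> s + 2 \<le> deg R x + deg (R\<inverse>) y"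
    and m: "card R \<le> 2 * s + 1"
    and ex: "(a0, b0) \<in> R" "(a1, b1) \<in> R" "a0 \<noteq> a1" "b0 \<noteq> b1"
  shows "2 * s + card (Domain R) + card (Range R) \<le> 2 * card R"
    and "2 * s + card (Domain R) + card (Range R) = 2 * card R \<Longrightarrow>
      card R = 2 * s + 1 \<and>
        (\<forall>a b a' b'. (a, b) \<in> R \<longrightarrow> (a', b') \<in> R \<longrightarrow> a \<noteq> a' \<longrightarrow> b \<noteq> b' \<longrightarrow>
          (a, b') \<in> R \<longleftrightarrow> (a', b) \<notin> R) \<or>
      (\<exists>a b a' b'. a \<noteq> a' \<and> b \<noteq> b' \<and> R = {a, a'} \<times> {b, b'})"
proof -
  let ?Q = "\<lambda>a b. {(x, y) \<in> R. x \<noteq> a \<and> y \<noteq> b \<and> (a, y) \<in> R \<and> (x, b) \<in> R}"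
  have finQ: "finite (?Q a b)" for a b by (rule finite_subset[OF _ fin]) auto
  have linked: "(a, b') \<in> R \<or> (a', b) \<in> R"
    if "(a, b) \<in> R" "(a', b') \<in> R" "a \<noteq> a'" "b \<noteq> b'" for a b a' b'
  proof (rule ccontr)
    assume "\<not> ?thesis"
    then have "R \<inter> {(a, b'), (a', b)} = {}" by auto
    with few_edges_linked(1)[OF fin s that] m show False by simp
  qed
  have cyc: "card (Domain R) + card (Range R) + card (?Q a b) \<le> card R + 1"
    if "(a, b) \<in> R" for a b
    by (rule vertices_plus_squares_le[OF fin that]) (use linked that in blast)
  have m2: "2 * s \<le> card R"
    using few_edges_linked(1)[OF fin s ex] card_links_le[of R a0 b1 a1 b0] by linarith
  have main: "2 * s + card (Domain R) + card (Range R) \<le> 2 * card R \<and>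
    (2 * s + card (Domain R) + card (Range R) = 2 * card R \<longrightarrow>
      card R = 2 * s + 1 \<and>
        (\<forall>a b a' b'. (a, b) \<in> R \<longrightarrow> (a', b') \<in> R \<longrightarrow> a \<noteq> a' \<longrightarrow> b \<noteq> b' \<longrightarrow>
          (a, b') \<in> R \<longleftrightarrow> (a', b) \<notin> R) \<or>
      (\<exists>a b a' b'. a \<noteq> a' \<and> b \<noteq> b' \<and> R = {a, a'} \<times> {b, b'}))"
  proof (cases "card R = 2 * s + 1")
    case True
    have "(a, b') \<in> R \<longleftrightarrow> (a', b) \<notin> R"
      if eq: "2 * s + card (Domain R) + card (Range R) = 2 * card R"
        and ab: "(a, b) \<in> R" "(a', b') \<in> R" "a \<noteq> a'" "b \<noteq> b'" for a b a' b'
    proof -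
      have "card (?Q a b) = 0" using cyc[OF ab(1)] eq True by linarith
      then have "?Q a b = {}" using finQ by simp
      then show ?thesis using ab linked[OF ab] by blast
    qed
    moreover have "2 * s + card (Domain R) + card (Range R) \<le> 2 * card R"
      using cyc[OF ex(1)] True by linarith
    ultimately show ?thesis using True by blast
  next
    case False
    with m m2 have m2: "card R = 2 * s" by simp
    have square: "(a, b') \<in> R \<and> (a', b) \<in> R"
      if ab: "(a, b) \<in> R" "(a', b') \<in> R" "a \<noteq> a'" "b \<noteq> b'" for a b a' b'
    proof -
      have "2 \<le> card (R \<inter> {(a, b'), (a', b)})"
        using few_edges_linked(1)[OF fin s ab] m2 by simp
      moreover have "card (R \<inter> {(a, b'), (a', b)}) \<le> 1"
        if "R \<inter> {(a, b'), (a', b)} \<subseteq> {z}" for z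
        using card_mono[OF _ that] by simp
      ultimately have "\<not> R \<inter> {(a, b'), (a', b)} \<subseteq> {z}" for z
        by fastforce
      from this[of "(a, b')"] this[of "(a', b)"] show ?thesis by auto
    qed
    have Q: "(a', b') \<in> ?Q a b" if "(a, b) \<in> R" "(a', b') \<in> R" "a \<noteq> a'" "b \<noteq> b'" for a b a' b'
      using square[OF that] that by auto
    have pos: "card (?Q a b) \<ge> 1" if "(a, b) \<in> R" "(a', b') \<in> R" "a \<noteq> a'" "b \<noteq> b'" for a b a' b'
    proof -
      have "?Q a b \<noteq> {}" using Q[OF that] by blast
      then show ?thesis using finQ[of a b] by (simp only: card_gt_0_iff Suc_le_eq One_nat_def simp_thms)
    qed
    have "R = {a0, a1} \<times> {b0, b1}"
      if eq: "2 * s + card (Domain R) + card (Range R) = 2 * card R"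
    proof -
      have uniq: "a' = x \<and> b' = y"
        if "(a, b) \<in> R" "(a', b') \<in> R" "a \<noteq> a'" "b \<noteq> b'" "(x, y) \<in> R" "a \<noteq> x" "b \<noteq> y"
        for a b a' b' x y
      proof -
        have "card (?Q a b) \<le> Suc 0" using cyc[OF that(1)] eq m2 by linarith
        then have "\<forall>p\<in>?Q a b. \<forall>q\<in>?Q a b. p = q"
          by (simp only: card_le_Suc0_iff_eq[OF finQ])
        then show ?thesis
          using Q[OF that(1-4)] Q[OF that(1,5) that(6,7)] by blast
      qed
      have sq: "(a0, b1) \<in> R" "(a1, b0) \<in> R" using square[OF ex] by auto
      have "x \<in> {a0, a1} \<and> y \<in> {b0, b1}" if xy: "(x, y) \<in> R" for x y
        using uniq[OF ex xy] uniq[OF ex(2,1) ex(3,4)[symmetric] xy]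
          uniq[OF sq ex(3) ex(4)[symmetric] xy] uniq[OF sq(2,1) ex(3)[symmetric] ex(4) xy]
          ex(3,4)
        unfolding insert_iff empty_iff by metis
      then have "R \<subseteq> {a0, a1} \<times> {b0, b1}" by auto
      moreover have "{a0, a1} \<times> {b0, b1} \<subseteq> R" using sq ex(1,2) by simp
      ultimately show ?thesis by (rule subset_antisym)
    qed
    moreover have "2 * s + card (Domain R) + card (Range R) \<le> 2 * card R"
      using cyc[OF ex(1)] pos[OF ex] m2 by linarith
    ultimately show ?thesis using ex(3,4)
      by (intro conjI impI disjI2 exI[of _ a0] exI[of _ b0] exI[of _ a1] exI[of _ b1])
  qed
  show "2 * s + card (Domain R) + card (Range R) \<le> 2 * card R"
    by (rule conjunct1[OF main])
  show "card R = 2 * s + 1 \<and>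
        (\<forall>a b a' b'. (a, b) \<in> R \<longrightarrow> (a', b') \<in> R \<longrightarrow> a \<noteq> a' \<longrightarrow> b \<noteq> b' \<longrightarrow>
          (a, b') \<in> R \<longleftrightarrow> (a', b) \<notin> R) \<or>
      (\<exists>a b a' b'. a \<noteq> a' \<and> b \<noteq> b' \<and> R = {a, a'} \<times> {b, b'})"
    if "2 * s + card (Domain R) + card (Range R) = 2 * card R"
    by (rule mp[OF conjunct2[OF main] that])
qed

lemma double_star_structure:
  fixes R :: "('a \<times> 'b) set"
  assumes fin: "finite R"
    and s: "\<And>x y. (x, y) \<in> R \<Longrightarrow> s + 2 \<le> deg R x + deg (R\<inverse>) y"
    and m: "card R = 2 * s + 1"
    and ex: "(a0, b0) \<in> R" "(a1, b1) \<in> R" "a0 \<noteq> a1" "b0 \<noteq> b1"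
    and link: "\<And>a b a' b'. (a, b) \<in> R \<Longrightarrow> (a', b') \<in> R \<Longrightarrow> a \<noteq> a' \<Longrightarrow> b \<noteq> b' \<Longrightarrow>
      (a, b') \<in> R \<longleftrightarrow> (a', b) \<notin> R"
  obtains a b where "a \<in> Domain R" "b \<in> Range R" "R = {a} \<times> Range R \<union> Domain R \<times> {b}"
    "card (Domain R) = s + 1" "card (Range R) = s + 1" "1 \<le> s"
proof -
  have "\<exists>a b x y. (a, x) \<in> R \<and> (y, b) \<in> R \<and> (a, b) \<in> R \<and> a \<noteq> y \<and> x \<noteq> b"
    using link[OF ex] ex by metis
  then obtain a b x y where ab: "(a, x) \<in> R" "(y, b) \<in> R" "a \<noteq> y" "x \<noteq> b" "(a, b) \<in> R" by blast
  have yx: "(y, x) \<notin> R" using link[OF ab(1-4)] ab(5) by simp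
  then have "R \<inter> {(a, b), (y, x)} = {(a, b)}" using ab by auto
  then have c: "card R + card (R \<inter> {(a, b), (y, x)}) = 2 * s + 2" using m by simp
  note F = few_edges_linked(2)[OF fin s ab(1-4) c]
  have touch: "p = a \<or> q = b" if pq: "(p, q) \<in> R" for p q
  proof (rule ccontr)
    assume n: "\<not> ?thesis"
    with F pq have "p = y \<or> q = x" by auto
    then show False
    proof
      assume "p = y"
      with pq n yx have yq: "(y, q) \<in> R" "b \<noteq> q" "x \<noteq> q" by auto
      show False using link[OF ab(1) yq(1) ab(3) yq(3)] link[OF ab(5) yq(1) ab(3) yq(2)] yx ab(2)
        by simp
    next
      assume "q = x"
      with pq n yx have px: "(p, x) \<in> R" "p \<noteq> a" "p \<noteq> y" by auto
      show False using link[OF px(1) ab(2) px(3) ab(4)] link[OF px(1) ab(5) px(2) ab(4)] yx ab(1)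
        by simp
    qed
  qed
  have R: "R = {a} \<times> Range R \<union> Domain R \<times> {b}"
  proof
    show "R \<subseteq> {a} \<times> Range R \<union> Domain R \<times> {b}" using touch by auto
    have "(a, q) \<in> R" if "(p, q) \<in> R" for p q using touch[OF that] that ab(5) by auto
    moreover have "(p, b) \<in> R" if "(p, q) \<in> R" for p q using touch[OF that] that ab(5) by auto
    ultimately show "{a} \<times> Range R \<union> Domain R \<times> {b} \<subseteq> R" by auto
  qed
  have "R\<inverse> `` {x} = {a}" "R `` {y} = {b}" using touch ab by auto
  then have "deg (R\<inverse>) x = 1" "deg R y = 1" by (auto simp: deg_def)
  moreover have "R `` {a} = Range R" "R\<inverse> `` {b} = Domain R"
    by (subst R, auto)+
  then have "deg R a = card (Range R)" "deg (R\<inverse>) b = card (Domain R)" by (auto simp: deg_def)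
  ultimately have cards: "card (Domain R) = s + 1" "card (Range R) = s + 1" using F by auto
  have "card {b, x} \<le> card (Range R)"
    by (rule card_mono) (use fin ab in \<open>auto simp: finite_Range\<close>)
  then have "1 \<le> s" using cards ab by auto
  with that[of a b] ab R cards show thesis by blast
qed

lemma two_stars_structure:
  fixes R :: "('a \<times> 'b) set"
  assumes fin: "finite R" and m: "card R = 2 * s + 2"
    and leaf: "\<And>x y. (x, y) \<in> R \<Longrightarrow>
      deg R x = 1 \<and> deg (R\<inverse>) y = s + 1 \<or> deg (R\<inverse>) y = 1 \<and> deg R x = s + 1"
    and e: "(a, b) \<in> R" "(a', b') \<in> R" "a \<noteq> a'" "b \<noteq> b'"
  obtains (left) c c' P Q where "c \<noteq> c'" "P \<inter> Q = {}" "card P = s + 1" "card Q = s + 1"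
      "R = {c} \<times> P \<union> {c'} \<times> Q"
    | (right) c c' P Q where "c \<noteq> c'" "P \<inter> Q = {}" "card P = s + 1" "card Q = s + 1"
      "R = P \<times> {c} \<union> Q \<times> {c'}"
    | (mixed) c c' P Q where "c \<notin> Q" "c' \<notin> P" "card P = s + 1" "card Q = s + 1"
      "R = {c} \<times> P \<union> Q \<times> {c'}"
proof -
  have one: "x = x' \<or> y = y'" if "(x, y) \<in> R" "(x, y') \<in> R" "(x', y') \<in> R" for x y x' y'
    using leaf[OF that(2)] deg_eq_oneD[of R x y y'] deg_eq_oneD[of "R\<inverse>" y' x x'] that by auto
  have "R \<inter> {(a, b'), (a', b)} = {}" using one[of a b b' a'] one[of a' b' b a] e by auto
  then have "card R + card (R \<inter> {(a, b'), (a', b)}) = 2 * s + 2" using m by simp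
  moreover have "s + 2 \<le> deg R x + deg (R\<inverse>) y" if "(x, y) \<in> R" for x y
    using leaf[OF that] by auto
  ultimately have touch: "x \<in> {a, a'} \<or> y \<in> {b, b'}" if "(x, y) \<in> R" for x y
    using few_edges_linked(2)[OF fin _ e] that by blast
  have nl: "(a, b') \<notin> R" "(a', b) \<notin> R" using one[of a b b' a'] one[of a' b' b a] e by auto
  have D: "deg R u = card (R `` {u})" "deg (R\<inverse>) v = card (R\<inverse> `` {v})" for u v
    by (simp_all add: deg_def)
  consider "deg (R\<inverse>) b = 1" "deg R a = s + 1" "deg (R\<inverse>) b' = 1" "deg R a' = s + 1"
    | "deg R a = 1" "deg (R\<inverse>) b = s + 1" "deg R a' = 1" "deg (R\<inverse>) b' = s + 1"
    | "deg (R\<inverse>) b = 1" "deg R a = s + 1" "deg R a' = 1" "deg (R\<inverse>) b' = s + 1"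
    | "deg R a = 1" "deg (R\<inverse>) b = s + 1" "deg (R\<inverse>) b' = 1" "deg R a' = s + 1"
    using leaf[OF e(1)] leaf[OF e(2)] by auto
  then show thesis
  proof cases
    case 1
    have x: "x = a \<or> x = a'" if "(x, y) \<in> R" for x y
      using touch[OF that] deg_eq_oneD[OF 1(1), of x a] deg_eq_oneD[OF 1(3), of x a'] e that by auto
    have "R = {a} \<times> (R `` {a}) \<union> {a'} \<times> (R `` {a'})" using x by auto
    moreover have "R `` {a} \<inter> R `` {a'} = {}"
    proof -
      have False if "(a, y) \<in> R" "(a', y) \<in> R" for y
        using one[OF e(1) that] one[OF e(2) that(2,1)] e by auto
      then show ?thesis by auto
    qed
    ultimately show thesis using left e(3) 1(2,4) unfolding D by metis
  next
    case 2
    have y: "y = b \<or> y = b'" if "(x, y) \<in> R" for x y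
      using touch[OF that] deg_eq_oneD[OF 2(1), of y b] deg_eq_oneD[OF 2(3), of y b'] e that by auto
    have "R = (R\<inverse> `` {b}) \<times> {b} \<union> (R\<inverse> `` {b'}) \<times> {b'}" using y by auto
    moreover have "R\<inverse> `` {b} \<inter> R\<inverse> `` {b'} = {}"
    proof -
      have False if "(x, b) \<in> R" "(x, b') \<in> R" for x
        using one[OF that(1,2) e(2)] one[OF that(2,1) e(1)] e by auto
      then show ?thesis by auto
    qed
    ultimately show thesis using right e(4) 2(2,4) unfolding D by metis
  next
    case 3
    have "x = a \<or> y = b'" if "(x, y) \<in> R" for x y
      using touch[OF that] deg_eq_oneD[OF 3(1), of x a] deg_eq_oneD[OF 3(3), of y b'] e that by auto
    then have "R = {a} \<times> (R `` {a}) \<union> (R\<inverse> `` {b'}) \<times> {b'}" by auto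
    moreover have "a \<notin> R\<inverse> `` {b'}" "b' \<notin> R `` {a}" using nl by auto
    ultimately show thesis using mixed 3(2,4) unfolding D by metis
  next
    case 4
    have "x = a' \<or> y = b" if "(x, y) \<in> R" for x y
      using touch[OF that] deg_eq_oneD[OF 4(1), of y b] deg_eq_oneD[OF 4(3), of x a'] e that by auto
    then have "R = {a'} \<times> (R `` {a'}) \<union> (R\<inverse> `` {b}) \<times> {b}" by auto
    moreover have "a' \<notin> R\<inverse> `` {b}" "b \<notin> R `` {a'}" using nl by auto
    ultimately show thesis using mixed 4(2,4) unfolding D by metis
  qed
qed

section \<open>Isomorphisms\<close>

definition edges_of :: "('a \<times> 'a) set \<Rightarrow> 'a set set" where
  "edges_of R = (\<lambda>(x, y). {x, y}) ` R"

lemma edges_of_converse [simp]: "edges_of (R\<inverse>) = edges_of R"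
  by (force simp: edges_of_def insert_commute)

lemma edges_of_Un: "edges_of (R \<union> S) = edges_of R \<union> edges_of S"
  by (simp add: edges_of_def image_Un)

lemma inj_on_edges:
  assumes "R \<subseteq> A \<times> B" "A \<inter> B = {}"
  shows "inj_on (\<lambda>(x, y). {x, y}) R"
  using assms by (fastforce simp: inj_on_def doubleton_eq_iff)

lemma card_edges_of:
  assumes "R \<subseteq> A \<times> B" "A \<inter> B = {}"
  shows "card (edges_of R) = card R"
  unfolding edges_of_def by (rule card_image[OF inj_on_edges[OF assms]])

lemma card_S1_edges_of:
  assumes fin: "finite R" and R: "R \<subseteq> A \<times> B" "A \<inter> B = {}" and xy: "(x, y) \<in> R"
  shows "card (S1 (edges_of R) {x, y}) + 2 = deg R x + deg (R\<inverse>) y"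
proof -
  define X where "X = Pair x ` (R `` {x} - {y})"
  define Y where "Y = (\<lambda>z. (z, y)) ` (R\<inverse> `` {y} - {x})"
  have XY: "X \<subseteq> R" "Y \<subseteq> R" by (auto simp: X_def Y_def)
  have fX: "finite X" "finite Y" using XY fin finite_subset by blast+
  have "S1 (edges_of R) {x, y} = (\<lambda>(x, y). {x, y}) ` (X \<union> Y)"
  proof
    show "S1 (edges_of R) {x, y} \<subseteq> (\<lambda>(x, y). {x, y}) ` (X \<union> Y)"
    proof
      fix e assume "e \<in> S1 (edges_of R) {x, y}"
      then obtain u v where uv: "(u, v) \<in> R" "e = {u, v}" "{u, v} \<noteq> {x, y}" "{u, v} \<inter> {x, y} \<noteq> {}"
        by (auto simp: S1_def edges_of_def)
      with R xy have "u \<in> A" "v \<in> B" "x \<in> A" "y \<in> B" by auto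
      with uv R(2) have "u = x \<and> v \<noteq> y \<or> v = y \<and> u \<noteq> x" by auto
      with uv(1) have "(u, v) \<in> X \<union> Y" by (auto simp: X_def Y_def)
      with uv(2) show "e \<in> (\<lambda>(x, y). {x, y}) ` (X \<union> Y)" by force
    qed
    have "{u, v} \<in> S1 (edges_of R) {x, y}" if "(u, v) \<in> X \<union> Y" for u v
    proof -
      have uv: "(u, v) \<in> R" "u = x \<and> v \<noteq> y \<or> v = y \<and> u \<noteq> x"
        using that by (auto simp: X_def Y_def)
      with R xy have "u \<in> A" "v \<in> B" "x \<in> A" "y \<in> B" by auto
      with uv(2) R(2) have "{u, v} \<noteq> {x, y}" "{u, v} \<inter> {x, y} \<noteq> {}"
        by (auto simp: doubleton_eq_iff)
      with uv(1) show ?thesis by (auto simp: S1_def edges_of_def)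
    qed
    then show "(\<lambda>(x, y). {x, y}) ` (X \<union> Y) \<subseteq> S1 (edges_of R) {x, y}" by auto
  qed
  then have "card (S1 (edges_of R) {x, y}) = card (X \<union> Y)"
    using inj_on_subset[OF inj_on_edges[OF R]] XY by (simp add: card_image)
  also have "\<dots> = card X + card Y"
    by (rule card_Un_disjoint[OF fX]) (auto simp: X_def Y_def)
  also have "card X = deg R x - 1"
    using xy unfolding X_def deg_def by (subst card_image) (auto simp: inj_on_def)
  also have "card Y = deg (R\<inverse>) y - 1"
    using xy unfolding Y_def deg_def by (subst card_image) (auto simp: inj_on_def)
  finally show ?thesis
    using deg_pos[OF fin xy] deg_converse_pos[OF fin xy] by linarith
qed

lemma bigraph_isoI:
  assumes g: "bij_betw g A A'" and h: "bij_betw h B B'"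
    and disj: "A \<inter> B = {}" "A' \<inter> B' = {}"
    and R: "R \<subseteq> A \<times> B" "map_prod g h ` R = R'"
  shows "bigraph_iso (A, B, edges_of R) (A', B', edges_of R')"
proof -
  define f where "f x = (if x \<in> A then g x else h x)" for x
  have fA: "f x = g x" if "x \<in> A" for x using that by (simp add: f_def)
  have fB: "f x = h x" if "x \<in> B" for x using that disj by (auto simp: f_def)
  have bA: "bij_betw f A A'" using g fA by (simp cong: bij_betw_cong)
  have bB: "bij_betw f B B'" using h fB by (simp cong: bij_betw_cong)
  have "bij_betw f (A \<union> B) (A' \<union> B')" by (rule bij_betw_combine[OF bA bB disj(2)])
  moreover have "(\<lambda>e. f ` e) ` edges_of R = edges_of R'"
  proof -
    have "(\<lambda>e. f ` e) ` edges_of R = (\<lambda>(x, y). {f x, f y}) ` R"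
      unfolding edges_of_def image_image by (rule image_cong) auto
    also have "\<dots> = (\<lambda>(x, y). {g x, h y}) ` R"
      by (rule image_cong) (use R(1) fA fB in auto)
    also have "\<dots> = edges_of R'" unfolding R(2)[symmetric] edges_of_def image_image
      by (rule image_cong) auto
    finally show ?thesis .
  qed
  moreover have "f ` A = A'" "f ` B = B'" using bA bB by (simp_all add: bij_betw_imp_surj_on)
  ultimately show ?thesis unfolding bigraph_iso_def prod.case by (intro exI[of _ f]) simp
qed

lemma bigraph_iso_swap: "bigraph_iso (A, B, E) H \<Longrightarrow> bigraph_iso (B, A, E) H"
  by (cases H) (auto simp: bigraph_iso_def Un_commute)

lemma graph_iso_if_bigraph_iso:
  "bigraph_iso (A, B, E) (A', B', E') \<Longrightarrow> graph_iso (A \<union> B) E (A' \<union> B') E'"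
  by (auto simp: bigraph_iso_def graph_iso_def)

lemma complete_bipartite_eq:
  "complete_bipartite s t = (Inl ` {1..s}, Inr ` {1..t}, edges_of (Inl ` {1..s} \<times> Inr ` {1..t}))"
  by (force simp: complete_bipartite_def edges_of_def)

lemma disjoint_union_eq:
  "disjoint_union (A, B, edges_of R) (A', B', edges_of R') =
    (Inl ` A \<union> Inr ` A', Inl ` B \<union> Inr ` B',
      edges_of (map_prod Inl Inl ` R \<union> map_prod Inr Inr ` R'))"
  by (simp add: disjoint_union_def edges_of_def image_Un image_image case_prod_unfold)

lemma H1_eq: "H1 n = (Inl ` {1..n}, Inr ` {1..n}, edges_of ((\<lambda>i. (Inl i, Inr i)) ` {1..n}))"
  by (auto simp: H1_def edges_of_def)

lemma map_prod_image_Times: "map_prod f g ` (A \<times> B) = (f ` A) \<times> (g ` B)"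
  by auto

lemma H2_eq:
  "H2 n = ({Inl (Inl 1), Inr (Inl 1)}, Inl ` Inr ` {1..n div 2} \<union> Inr ` Inr ` {1..n div 2},
    edges_of ({Inl (Inl 1)} \<times> Inl ` Inr ` {1..n div 2} \<union> {Inr (Inl 1)} \<times> Inr ` Inr ` {1..n div 2}))"
  unfolding H2_def complete_bipartite_eq disjoint_union_eq map_prod_image_Times
  by (simp add: insert_commute)

lemma H3_eq:
  "H3 n = ({Inl (Inl 1)} \<union> Inr ` Inr ` {1..n div 2}, Inl ` Inr ` {1..n div 2} \<union> {Inr (Inl 1)},
    edges_of ({Inl (Inl 1)} \<times> Inl ` Inr ` {1..n div 2} \<union> Inr ` Inr ` {1..n div 2} \<times> {Inr (Inl 1)}))"
proof -
  have "swap_parts (complete_bipartite 1 k) =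
      (Inr ` {1..k}, Inl ` {1..1}, edges_of (Inr ` {1..k} \<times> Inl ` {1..1}))" for k
    unfolding complete_bipartite_eq swap_parts_def
    by (subst edges_of_converse[symmetric]) (simp add: converse_Times)
  then show ?thesis
    unfolding H3_def by (simp add: complete_bipartite_eq disjoint_union_eq map_prod_image_Times)
qed

lemma H4_eq:
  assumes "k = (n + 1) div 2"
  shows "H4 n = (Inl ` {1..k}, Inr ` {1..k},
    edges_of ({Inl 1} \<times> Inr ` {1..k} \<union> Inl ` {1..k} \<times> {Inr k}))"
proof -
  have "{{Inl 1, Inr j} |j. j \<in> {1..k}} = edges_of ({Inl 1 :: nat + nat} \<times> Inr ` {1..k})"
    "{{Inl i, Inr k} |i. i \<in> {1..k}} = edges_of (Inl ` {1..k} \<times> {Inr k :: nat + nat})"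
    by (force simp: edges_of_def)+
  then show ?thesis unfolding H4_def Let_def assms[symmetric] edges_of_Un by simp
qed

lemma bigraph_iso_completeI:
  assumes "finite A" "finite B" "A \<inter> B = {}"
  shows "bigraph_iso (A, B, edges_of (A \<times> B)) (complete_bipartite (card A) (card B))"
proof -
  obtain g h where gh: "bij_betw g A (Inl ` {1..card A} :: (nat + nat) set)"
    "bij_betw h B (Inr ` {1..card B} :: (nat + nat) set)"
    using assms finite_same_card_bij[of A "Inl ` {1..card A} :: (nat + nat) set"]
      finite_same_card_bij[of B "Inr ` {1..card B} :: (nat + nat) set"]
    by (auto simp: card_image)
  show ?thesis unfolding complete_bipartite_eq
    by (rule bigraph_isoI[OF gh assms(3)])
      (use gh in \<open>auto simp: map_prod_image_Times bij_betw_def\<close>)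
qed

lemma bigraph_iso_H1I:
  assumes fin: "finite R" and disj: "Domain R \<inter> Range R = {}"
    and one: "\<And>x y. (x, y) \<in> R \<Longrightarrow> deg R x = 1 \<and> deg (R\<inverse>) y = 1"
  shows "bigraph_iso (Domain R, Range R, edges_of R) (H1 (card R))"
proof -
  obtain p :: "'a \<times> 'a \<Rightarrow> nat" where p: "bij_betw p R {1..card R}"
    using finite_same_card_bij[OF fin, of "{1..card R}"] by auto
  have fst: "inj_on fst R" and snd: "inj_on snd R"
    using one deg_eq_oneD[of R] deg_eq_oneD[of "R\<inverse>"]
    by (auto simp: inj_on_def)
  define g :: "'a \<Rightarrow> nat + nat" where "g = (Inl \<circ> p) \<circ> inv_into R fst"
  define h :: "'a \<Rightarrow> nat + nat" where "h = (Inr \<circ> p) \<circ> inv_into R snd"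
  have g: "g (fst e) = Inl (p e)" "h (snd e) = Inr (p e)" if "e \<in> R" for e
    using that fst snd by (auto simp: g_def h_def)
  have b1: "bij_betw (inv_into R fst) (Domain R) R"
    by (rule bij_betw_inv_into) (use fst in \<open>auto simp: bij_betw_def Domain_fst\<close>)
  have b2: "bij_betw (inv_into R snd) (Range R) R"
    by (rule bij_betw_inv_into) (use snd in \<open>auto simp: bij_betw_def Range_snd\<close>)
  have "bij_betw (Inl \<circ> p :: 'a \<times> 'a \<Rightarrow> nat + nat) R (Inl ` {1..card R})"
    "bij_betw (Inr \<circ> p :: 'a \<times> 'a \<Rightarrow> nat + nat) R (Inr ` {1..card R})"
    by (rule bij_betw_trans[OF p], simp add: bij_betw_def)+
  note pI = this
  have bij: "bij_betw g (Domain R) (Inl ` {1..card R})"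
    "bij_betw h (Range R) (Inr ` {1..card R})"
    unfolding g_def h_def
    by (rule bij_betw_trans[OF b1 pI(1)] bij_betw_trans[OF b2 pI(2)])+
  have "map_prod g h ` R = (\<lambda>i. (Inl i, Inr i)) ` p ` R"
    unfolding image_image by (rule image_cong) (auto simp: g[of "(_, _)", simplified])
  also have "p ` R = {1..card R}" using p by (simp add: bij_betw_def)
  finally show ?thesis unfolding H1_eq
    by (intro bigraph_isoI[OF bij disj]) (auto intro: Domain.intros Range.intros)
qed

lemma bigraph_iso_H2I:
  assumes "c \<noteq> c'" "P \<inter> Q = {}" "card P = k" "card Q = k" "1 \<le> k"
    and "{c, c'} \<inter> (P \<union> Q) = {}"
  shows "bigraph_iso ({c, c'}, P \<union> Q, edges_of ({c} \<times> P \<union> {c'} \<times> Q)) (H2 (2 * k))"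
proof -
  have fin: "finite P" "finite Q" using assms card_ge_0_finite by fastforce+
  obtain p where p: "bij_betw p P (Inl ` Inr ` {1..k} :: ((nat + nat) + (nat + nat)) set)"
    using finite_same_card_bij[OF fin(1), of "Inl ` Inr ` {1..k} :: ((nat + nat) + (nat + nat)) set"] assms
    by (auto simp: card_image)
  obtain q where q: "bij_betw q Q (Inr ` Inr ` {1..k} :: ((nat + nat) + (nat + nat)) set)"
    using finite_same_card_bij[OF fin(2), of "Inr ` Inr ` {1..k} :: ((nat + nat) + (nat + nat)) set"] assms
    by (auto simp: card_image)
  define g :: "'a \<Rightarrow> (nat + nat) + (nat + nat)"
    where "g x = (if x = c then Inl (Inl 1) else Inr (Inl 1))" for x
  define h where "h x = (if x \<in> P then p x else q x)" for x
  have hp: "bij_betw h P (Inl ` Inr ` {1..k})" using p by (simp add: h_def cong: bij_betw_cong)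
  have "h x = q x" if "x \<in> Q" for x using that assms(2) by (auto simp: h_def)
  then have hq: "bij_betw h Q (Inr ` Inr ` {1..k})" using q by (simp cong: bij_betw_cong)
  have g: "bij_betw g {c, c'} {Inl (Inl 1), Inr (Inl 1)}"
    using assms(1) by (auto simp: bij_betw_def g_def)
  have h: "bij_betw h (P \<union> Q) (Inl ` Inr ` {1..k} \<union> Inr ` Inr ` {1..k})"
    by (rule bij_betw_combine[OF hp hq]) auto
  have k: "2 * k div 2 = k" by simp
  have g1: "g c = Inl (Inl 1)" "g c' = Inr (Inl 1)" using assms(1) by (simp_all add: g_def)
  show ?thesis unfolding H2_eq k
  proof (rule bigraph_isoI[OF g h])
    show "map_prod g h ` ({c} \<times> P \<union> {c'} \<times> Q) =
        {Inl (Inl 1)} \<times> Inl ` Inr ` {1..k} \<union> {Inr (Inl 1)} \<times> Inr ` Inr ` {1..k}"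
      by (simp only: image_Un map_prod_image_Times image_insert image_empty g1
          bij_betw_imp_surj_on[OF hp] bij_betw_imp_surj_on[OF hq])
  qed (use assms(6) in auto)
qed

lemma bigraph_iso_H3I:
  assumes "c \<notin> Q" "c' \<notin> P" "card P = k" "card Q = k" "1 \<le> k"
    and "insert c Q \<inter> insert c' P = {}"
  shows "bigraph_iso ({c} \<union> Q, P \<union> {c'}, edges_of ({c} \<times> P \<union> Q \<times> {c'})) (H3 (2 * k))"
proof -
  have fin: "finite P" "finite Q" using assms card_ge_0_finite by fastforce+
  obtain p where p: "bij_betw p P (Inl ` Inr ` {1..k} :: ((nat + nat) + (nat + nat)) set)"
    using finite_same_card_bij[OF fin(1), of "Inl ` Inr ` {1..k} :: ((nat + nat) + (nat + nat)) set"] assms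
    by (auto simp: card_image)
  obtain q where q: "bij_betw q Q (Inr ` Inr ` {1..k} :: ((nat + nat) + (nat + nat)) set)"
    using finite_same_card_bij[OF fin(2), of "Inr ` Inr ` {1..k} :: ((nat + nat) + (nat + nat)) set"] assms
    by (auto simp: card_image)
  define g where "g x = (if x = c then Inl (Inl 1) else q x)" for x
  define h where "h x = (if x = c' then Inr (Inl 1) else p x)" for x
  have "h x = p x" if "x \<in> P" for x using that assms(2) by (auto simp: h_def)
  then have hp: "bij_betw h P (Inl ` Inr ` {1..k})" using p by (simp cong: bij_betw_cong)
  have "g x = q x" if "x \<in> Q" for x using that assms(1) by (auto simp: g_def)
  then have gq: "bij_betw g Q (Inr ` Inr ` {1..k})" using q by (simp cong: bij_betw_cong)
  have c: "bij_betw g {c} {Inl (Inl 1)}" "bij_betw h {c'} {Inr (Inl 1)}"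
    by (auto simp: bij_betw_def g_def h_def)
  have g: "bij_betw g ({c} \<union> Q) ({Inl (Inl 1)} \<union> Inr ` Inr ` {1..k})"
    by (rule bij_betw_combine[OF c(1) gq]) auto
  have h: "bij_betw h (P \<union> {c'}) (Inl ` Inr ` {1..k} \<union> {Inr (Inl 1)})"
    by (rule bij_betw_combine[OF hp c(2)]) auto
  have k: "2 * k div 2 = k" by simp
  show ?thesis unfolding H3_eq k
  proof (rule bigraph_isoI[OF g h])
    show "map_prod g h ` ({c} \<times> P \<union> Q \<times> {c'}) =
        {Inl (Inl 1)} \<times> Inl ` Inr ` {1..k} \<union> Inr ` Inr ` {1..k} \<times> {Inr (Inl 1)}"
      by (simp only: image_Un map_prod_image_Times bij_betw_imp_surj_on[OF hp]
          bij_betw_imp_surj_on[OF gq] bij_betw_imp_surj_on[OF c(1)] bij_betw_imp_surj_on[OF c(2)])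
    show "({c} \<union> Q) \<inter> (P \<union> {c'}) = {}" using assms(6) by auto
  qed auto
qed

lemma bij_betw_fixing_point:
  assumes "finite A" "card A = card A'" "finite A'" "a \<in> A" "a' \<in> A'"
  obtains g where "bij_betw g A A'" "g a = a'"
proof -
  obtain p where p: "bij_betw p (A - {a}) (A' - {a'})"
    using finite_same_card_bij[of "A - {a}" "A' - {a'}"] assms by auto
  define g where "g x = (if x = a then a' else p x)" for x
  have "bij_betw g (A - {a}) (A' - {a'})" 
    by (rule bij_betw_cong[THEN iffD1, OF _ p]) (auto simp: g_def)
  moreover have "bij_betw g {a} {a'}" by (simp add: bij_betw_def g_def)
  ultimately have "bij_betw g ((A - {a}) \<union> {a}) ((A' - {a'}) \<union> {a'})"
    by (rule bij_betw_combine) auto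
  then have "bij_betw g A A'" using assms(4,5) by (simp add: insert_absorb)
  then show thesis using that[of g] by (simp add: g_def)
qed

lemma bigraph_iso_H4I:
  assumes "finite A" "finite B" "A \<inter> B = {}" "a \<in> A" "b \<in> B" "card A = k" "card B = k"
  shows "bigraph_iso (A, B, edges_of ({a} \<times> B \<union> A \<times> {b})) (H4 (2 * k - 1))"
proof -
  have k: "1 \<le> k" using assms card_gt_0_iff by (metis One_nat_def Suc_leI empty_iff)
  obtain g where g: "bij_betw g A (Inl ` {1..k} :: (nat + nat) set)" "g a = Inl 1"
    by (rule bij_betw_fixing_point[of A "Inl ` {1..k} :: (nat + nat) set" a "Inl 1"])
      (use assms k in \<open>auto simp: card_image\<close>)
  obtain h where h: "bij_betw h B (Inr ` {1..k} :: (nat + nat) set)" "h b = Inr k"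
    by (rule bij_betw_fixing_point[of B "Inr ` {1..k} :: (nat + nat) set" b "Inr k"])
      (use assms k in \<open>auto simp: card_image\<close>)
  have k2: "k = (2 * k - 1 + 1) div 2" using k by simp
  show ?thesis unfolding H4_eq[OF k2]
  proof (rule bigraph_isoI[OF g(1) h(1) assms(3)])
    show "map_prod g h ` ({a} \<times> B \<union> A \<times> {b}) =
        {Inl 1} \<times> Inr ` {1..k} \<union> Inl ` {1..k} \<times> {Inr k}"
      by (simp only: image_Un map_prod_image_Times image_insert image_empty g(2) h(2)
          bij_betw_imp_surj_on[OF g(1)] bij_betw_imp_surj_on[OF h(1)])
  qed (use assms(4,5) in auto)
qed

section \<open>The extremal graphs\<close>

lemma S1_image:
  assumes inj: "inj_on f V" and E: "\<Union>E \<subseteq> V" and e: "e \<in> E"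
  shows "S1 ((`) f ` E) (f ` e) = (`) f ` S1 E e"
proof -
  have inv: "f ` e' \<noteq> f ` e \<longleftrightarrow> e' \<noteq> e" "f ` e' \<inter> f ` e \<noteq> {} \<longleftrightarrow> e' \<inter> e \<noteq> {}" if "e' \<in> E" for e'
  proof -
    have "e' \<subseteq> V" "e \<subseteq> V" using E e that by auto
    then show "f ` e' \<noteq> f ` e \<longleftrightarrow> e' \<noteq> e" "f ` e' \<inter> f ` e \<noteq> {} \<longleftrightarrow> e' \<inter> e \<noteq> {}"
      using inj_on_image_eq_iff[OF inj] inj_on_image_Int[OF inj, of e' e] by auto
  qed
  show ?thesis
    unfolding S1_def Compr_image_eq
    by (intro arg_cong[of _ _ "(`) ((`) f)"] Collect_cong conj_cong refl inv)
qed

text \<open>In terms of edges, the inequality says $|S_1(e)| \ge m - N/2$ for every edge \<open>e\<close>.\<close>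

definition tight :: "('a \<times> 'a) set \<Rightarrow> bool" where
  "tight R \<longleftrightarrow> finite R \<and> Domain R \<inter> Range R = {} \<and>
    (\<forall>(x, y) \<in> R. 2 * card R + 4 \<le>
      2 * (deg R x + deg (R\<inverse>) y) + (card (Domain R) + card (Range R)))"

lemma bigraph_iso_tight:
  assumes iso: "bigraph_iso (A, B, E) (A', B', edges_of R)"
    and E: "\<Union>E \<subseteq> A \<union> B" and e: "e \<in> E"
    and R: "A' = Domain R" "B' = Range R" and tight: "tight R"
  shows "2 * card E \<le> 2 * card (S1 E e) + card (A \<union> B)"
proof -
  obtain f where f: "bij_betw f (A \<union> B) (Domain R \<union> Range R)" "(`) f ` E = edges_of R"
    using iso R by (auto simp: bigraph_iso_def)
  have inj: "inj_on f (A \<union> B)" using f(1) by (simp add: bij_betw_def)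
  have injE: "inj_on ((`) f) E"
    by (rule inj_on_subset[OF inj_on_image_Pow[OF inj]]) (use E in auto)
  have T: "finite R" "R \<subseteq> Domain R \<times> Range R" "Domain R \<inter> Range R = {}"
    using tight by (auto simp: tight_def)
  have cE: "card R = card E"
    using card_image[OF injE] f(2) card_edges_of[OF T(2,3)] by simp
  have cV: "card (Domain R) + card (Range R) = card (A \<union> B)"
    using bij_betw_same_card[OF f(1)] T by (simp add: card_Un_disjoint finite_Domain finite_Range)
  have "f ` e \<in> edges_of R" using f(2) e by blast
  then obtain x y where xy: "(x, y) \<in> R" "f ` e = {x, y}"
    by (auto simp: edges_of_def)
  have "card (S1 (edges_of R) {x, y}) = card ((`) f ` S1 E e)"
    using S1_image[OF inj E e] f(2) xy(2) by simp
  also have "\<dots> = card (S1 E e)"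
    by (rule card_image[OF inj_on_subset[OF injE]]) (auto simp: S1_def)
  finally have "card (S1 E e) + 2 = deg R x + deg (R\<inverse>) y"
    using card_S1_edges_of[OF T xy(1)] by simp
  moreover have "2 * card R + 4 \<le>
      2 * (deg R x + deg (R\<inverse>) y) + (card (Domain R) + card (Range R))"
    using tight xy(1) unfolding tight_def by blast
  ultimately show ?thesis using cE cV by simp
qed

lemma tight_complete:
  assumes "card A = 2" "card B = 2" "A \<inter> B = {}"
  shows "tight (A \<times> B)"
proof -
  have AB: "finite A" "finite B" using assms card_ge_0_finite by fastforce+
  then have fin: "finite (A \<times> B)" "finite ((A \<times> B)\<inverse>)" by simp_all
  have "A \<noteq> {}" "B \<noteq> {}" using assms by auto
  then have D: "Domain (A \<times> B) = A" "Range (A \<times> B) = B" by auto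
  have "2 \<le> deg (A \<times> B) x \<and> 2 \<le> deg ((A \<times> B)\<inverse>) y" if "(x, y) \<in> A \<times> B" for x y
    using that deg_ge_card[OF fin(1), of x B] deg_ge_card[OF fin(2), of y A] assms by auto
  then show ?thesis
    using assms fin unfolding tight_def D by (fastforce simp: card_cartesian_product)
qed

lemma tight_matching: "tight ((\<lambda>i. (Inl i, Inr i)) ` {1..n} :: ((nat + nat) \<times> (nat + nat)) set)"
  (is "tight ?R")
proof -
  have fin: "finite ?R" by simp
  have D: "Domain ?R = Inl ` {1..n}" "Range ?R = Inr ` {1..n}" by auto
  have "card ?R = n" by (simp add: card_image inj_on_def)
  then show ?thesis unfolding tight_def D
    using deg_pos[OF fin] deg_converse_pos[OF fin] by (fastforce simp: card_image)
qed

lemma tight_two_stars_same: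
  assumes "finite P" "finite Q" "card P = k" "card Q = k" "1 \<le> k" "P \<inter> Q = {}" "c \<noteq> c'"
    and "{c, c'} \<inter> (P \<union> Q) = {}"
  shows "tight ({c} \<times> P \<union> {c'} \<times> Q)" (is "tight ?R")
proof -
  have ne: "P \<noteq> {}" "Q \<noteq> {}" using assms by auto
  have fin: "finite ?R" using assms by simp
  have D: "Domain ?R = {c, c'}" "Range ?R = P \<union> Q" using ne by auto
  have cR: "card ?R = 2 * k"
    using assms by (subst card_Un_disjoint) (auto simp: card_cartesian_product)
  have "2 * card ?R + 4 \<le> 2 * (deg ?R x + deg (?R\<inverse>) y) + (card {c, c'} + card (P \<union> Q))"
    if xy: "(x, y) \<in> ?R" for x y
  proof -
    have "k \<le> deg ?R c" "k \<le> deg ?R c'"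
      using deg_ge_card[OF fin, of c P] deg_ge_card[OF fin, of c' Q] assms by auto
    then have "k \<le> deg ?R x" using xy by auto
    moreover have "card (P \<union> Q) = 2 * k" using assms by (simp add: card_Un_disjoint)
    ultimately show ?thesis using deg_converse_pos[OF fin xy] cR assms(7) by simp
  qed
  then show ?thesis unfolding tight_def D using fin assms(8) by blast
qed

lemma tight_two_stars_opposite:
  assumes "finite P" "finite Q" "card P = k" "card Q = k" "1 \<le> k" "c \<notin> Q" "c' \<notin> P"
    and "insert c Q \<inter> insert c' P = {}"
  shows "tight ({c} \<times> P \<union> Q \<times> {c'})" (is "tight ?R")
proof -
  have ne: "P \<noteq> {}" "Q \<noteq> {}" using assms by auto
  have fin: "finite ?R" using assms by simp
  have D: "Domain ?R = insert c Q" "Range ?R = insert c' P" using ne by auto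
  have cR: "card ?R = 2 * k"
    using assms by (subst card_Un_disjoint) (auto simp: card_cartesian_product)
  have "2 * card ?R + 4 \<le> 2 * (deg ?R x + deg (?R\<inverse>) y) + (card (insert c Q) + card (insert c' P))"
    if xy: "(x, y) \<in> ?R" for x y
  proof -
    have "k \<le> deg ?R c" "k \<le> deg (?R\<inverse>) c'"
      using deg_ge_card[OF fin, of c P] deg_ge_card[of "?R\<inverse>" c' Q] fin assms by auto
    then have "k + 1 \<le> deg ?R x + deg (?R\<inverse>) y"
      using xy deg_pos[OF fin xy] deg_converse_pos[OF fin xy] by auto
    moreover have "card (insert c Q) = k + 1" "card (insert c' P) = k + 1" using assms by auto
    ultimately show ?thesis using cR by simp
  qed
  then show ?thesis unfolding tight_def D using fin assms(8) by blast
qed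

lemma tight_double_star:
  assumes "finite A" "finite B" "A \<inter> B = {}" "a \<in> A" "b \<in> B" "card A = k" "card B = k"
  shows "tight ({a} \<times> B \<union> A \<times> {b})" (is "tight ?R")
proof -
  have fin: "finite ?R" using assms by simp
  have D: "Domain ?R = A" "Range ?R = B" using assms by auto
  have "({a} \<times> B) \<inter> (A \<times> {b}) = {(a, b)}" using assms by auto
  then have cR: "card ?R + 1 = 2 * k"
    using card_Un_Int[of "{a} \<times> B" "A \<times> {b}"] assms by (simp add: card_cartesian_product)
  have "2 * card ?R + 4 \<le> 2 * (deg ?R x + deg (?R\<inverse>) y) + (card A + card B)"
    if xy: "(x, y) \<in> ?R" for x y
  proof -
    have "k \<le> deg ?R a" "k \<le> deg (?R\<inverse>) b"
      using deg_ge_card[OF fin, of a B] deg_ge_card[of "?R\<inverse>" b A] fin assms by auto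
    then have "k + 1 \<le> deg ?R x + deg (?R\<inverse>) y"
      using xy deg_pos[OF fin xy] deg_converse_pos[OF fin xy] by auto
    then show ?thesis using cR assms by simp
  qed
  then show ?thesis unfolding tight_def D using fin assms(3) by blast
qed

lemma Domain_Times: "B \<noteq> {} \<Longrightarrow> Domain (A \<times> B) = A"
  by auto

lemma Range_Times: "A \<noteq> {} \<Longrightarrow> Range (A \<times> B) = B"
  by auto

lemma extremal_graphs_tight:
  assumes iso: "bigraph_iso (A, B, E) (complete_bipartite 2 2) \<or>
      (\<exists>n\<ge>2. bigraph_iso (A, B, E) (H1 n)) \<or>
      (\<exists>n\<ge>2. even n \<and> bigraph_iso (A, B, E) (H2 n)) \<or>
      (\<exists>n\<ge>2. even n \<and> bigraph_iso (A, B, E) (H3 n)) \<or>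
      (\<exists>n\<ge>3. odd n \<and> bigraph_iso (A, B, E) (H4 n))"
    and E: "\<Union>E \<subseteq> A \<union> B" and e: "e \<in> E"
  shows "2 * card E \<le> 2 * card (S1 E e) + card (A \<union> B)"
  using iso
proof (elim disjE exE conjE)
  assume *: "bigraph_iso (A, B, E) (complete_bipartite 2 2)"
  show ?thesis
    by (rule bigraph_iso_tight[OF *[unfolded complete_bipartite_eq] E e _ _ tight_complete])
      (auto simp: card_image)
next
  fix n :: nat assume *: "bigraph_iso (A, B, E) (H1 n)"
  show ?thesis
    by (rule bigraph_iso_tight[OF *[unfolded H1_eq] E e _ _ tight_matching]) auto
next
  fix n :: nat assume *: "bigraph_iso (A, B, E) (H2 n)" and n: "2 \<le> n"
  define k where "k = n div 2"
  with n have k: "1 \<le> k" by simp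
  then have ne: "{1..k} \<noteq> {}" by simp
  show ?thesis
  proof (rule bigraph_iso_tight[OF *[unfolded H2_eq, folded k_def] E e])
    show "tight ({Inl (Inl 1)} \<times> Inl ` Inr ` {1..k} \<union> {Inr (Inl 1)} \<times> Inr ` Inr ` {1..k} ::
        (((nat + nat) + (nat + nat)) \<times> _) set)"
      by (rule tight_two_stars_same[where k = k]) (use k in \<open>auto simp: card_image\<close>)
  qed (use ne in \<open>auto simp: Domain_Un_eq Range_Un_eq Domain_Times Range_Times simp del: atLeastatMost_empty_iff\<close>)
next
  fix n :: nat assume *: "bigraph_iso (A, B, E) (H3 n)" and n: "2 \<le> n"
  define k where "k = n div 2"
  with n have k: "1 \<le> k" by simp
  then have ne: "{1..k} \<noteq> {}" by simp
  show ?thesis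
  proof (rule bigraph_iso_tight[OF *[unfolded H3_eq, folded k_def] E e])
    show "tight ({Inl (Inl 1)} \<times> Inl ` Inr ` {1..k} \<union> Inr ` Inr ` {1..k} \<times> {Inr (Inl 1)} ::
        (((nat + nat) + (nat + nat)) \<times> _) set)"
      by (rule tight_two_stars_opposite[where k = k]) (use k in \<open>auto simp: card_image\<close>)
  qed (use ne in \<open>auto simp: Domain_Un_eq Range_Un_eq Domain_Times Range_Times simp del: atLeastatMost_empty_iff\<close>)
next
  fix n :: nat assume *: "bigraph_iso (A, B, E) (H4 n)" and n: "3 \<le> n"
  define k where "k = (n + 1) div 2"
  with n have k: "1 \<le> k" by simp
  show ?thesis
  proof (rule bigraph_iso_tight[OF *[unfolded H4_eq[OF k_def]] E e])
    show "tight ({Inl 1} \<times> Inr ` {1..k} \<union> Inl ` {1..k} \<times> {Inr k} :: ((nat + nat) \<times> _) set)"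
      by (rule tight_double_star[where k = k]) (use k in \<open>auto simp: card_image\<close>)
  qed (use k in auto)
qed

lemma no_disjoint_edges:
  assumes "R \<noteq> {}"
    and nd: "\<And>a b a' b'. (a, b) \<in> R \<Longrightarrow> (a', b') \<in> R \<Longrightarrow> a = a' \<or> b = b'"
  shows "(\<exists>a. R = {a} \<times> Range R) \<or> (\<exists>b. R = Domain R \<times> {b})"
proof (cases "\<exists>a. Domain R \<subseteq> {a}")
  case True
  then obtain a where a: "Domain R \<subseteq> {a}" by blast
  then have "R = {a} \<times> Range R" by auto
  then show ?thesis by blast
next
  case False
  obtain a b where ab: "(a, b) \<in> R" using assms(1) by auto
  obtain x y where xy: "(x, y) \<in> R" "x \<noteq> a" using False ab by blast
  then have "y = b" using nd[OF ab xy(1)] by auto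
  have "z = b" if "(w, z) \<in> R" for w z
    using nd[OF that ab] nd[OF that xy(1)] xy(2) \<open>y = b\<close> by auto
  then have "R = Domain R \<times> {b}" by auto
  then show ?thesis by blast
qed

lemma star_graphI:
  assumes R: "finite R" "Domain R \<inter> Range R = {}" "R \<noteq> {}"
    and nd: "\<And>a b a' b'. (a, b) \<in> R \<Longrightarrow> (a', b') \<in> R \<Longrightarrow> a = a' \<or> b = b'"
  shows "star_graph (Domain R \<union> Range R) (edges_of R)"
proof -
  have star: "star_graph ({a} \<union> B) (edges_of ({a} \<times> B))" if "finite B" "B \<noteq> {}" "a \<notin> B"
    for a :: 'a and B
  proof -
    have "bigraph_iso ({a}, B, edges_of ({a} \<times> B)) (complete_bipartite 1 (card B))"
      using bigraph_iso_completeI[of "{a}" B] that by simp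
    moreover have "card B \<ge> 1" using that by (simp add: Suc_le_eq card_gt_0_iff)
    ultimately show ?thesis
      unfolding star_graph_def complete_bipartite_eq prod.case
      by (intro exI[of _ "card B"] conjI graph_iso_if_bigraph_iso)
  qed
  have "(\<exists>a. R = {a} \<times> Range R) \<or> (\<exists>b. R = Domain R \<times> {b})"
    by (rule no_disjoint_edges[OF R(3)]) (rule nd)
  then show ?thesis
  proof (elim disjE exE)
    fix a assume a: "R = {a} \<times> Range R"
    then have D: "Domain R = {a}" using R(3) by auto
    have "star_graph ({a} \<union> Range R) (edges_of ({a} \<times> Range R))"
      by (rule star) (use R D finite_Range in auto)
    then show ?thesis unfolding D a[symmetric] .
  next
    fix b assume b: "R = Domain R \<times> {b}"
    then have D: "Range R = {b}" using R(3) by auto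
    have "star_graph ({b} \<union> Domain R) (edges_of ({b} \<times> Domain R))"
      by (rule star) (use R D finite_Domain in auto)
    moreover have "{b} \<times> Domain R = R\<inverse>" by (metis b converse_Times)
    ultimately show ?thesis by (simp add: D Un_commute)
  qed
qed

lemma tight_imp_extremal_graph:
  fixes R :: "('a \<times> 'a) set"
  assumes fin: "finite R" and disj: "Domain R \<inter> Range R = {}"
    and s: "\<And>x y. (x, y) \<in> R \<Longrightarrow> s + 2 \<le> deg R x + deg (R\<inverse>) y"
    and ex: "(a0, b0) \<in> R" "(a1, b1) \<in> R" "a0 \<noteq> a1" "b0 \<noteq> b1"
    and eq: "2 * s + card (Domain R) + card (Range R) = 2 * card R"
  shows "bigraph_iso (Domain R, Range R, edges_of R) (complete_bipartite 2 2) \<or>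
      (\<exists>n\<ge>2. bigraph_iso (Domain R, Range R, edges_of R) (H1 n)) \<or>
      (\<exists>n\<ge>2. even n \<and> bigraph_iso (Domain R, Range R, edges_of R) (H2 n)) \<or>
      (\<exists>n\<ge>2. even n \<and> bigraph_iso (Domain R, Range R, edges_of R) (H3 n)) \<or>
      (\<exists>n\<ge>3. odd n \<and> bigraph_iso (Domain R, Range R, edges_of R) (H4 n))"
    (is "?K22 \<or> ?H1 \<or> ?H2 \<or> ?H3 \<or> ?H4")
proof (cases "2 * s + 2 \<le> card R \<or> s = 0")
  case True
  have leaf: "deg R x = 1 \<and> deg (R\<inverse>) y = s + 1 \<or> deg (R\<inverse>) y = 1 \<and> deg R x = s + 1"
    if "(x, y) \<in> R" for x y
    by (rule many_edges_bound(2)[OF fin s True eq that])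
  show ?thesis
  proof (cases "s = 0")
    case True
    have "deg R x = 1 \<and> deg (R\<inverse>) y = 1" if "(x, y) \<in> R" for x y
      using leaf[OF that] True by auto
    note bigraph_iso_H1I[OF fin disj this]
    moreover have "card {(a0, b0), (a1, b1)} \<le> card R"
      by (rule card_mono[OF fin]) (use ex in auto)
    then have "2 \<le> card R" using ex(3) by simp
    ultimately have ?H1 by blast
    then show ?thesis by blast
  next
    case False
    then have m: "card R = 2 * s + 2" using many_edges_bound(3)[OF fin s True eq] by simp
    have n: "2 * (s + 1) \<ge> 2" "even (2 * (s + 1))" by simp_all
    show ?thesis
    proof (rule two_stars_structure[OF fin m leaf ex])
      fix c c' P Q
      assume *: "c \<noteq> c'" "P \<inter> Q = {}" "card P = s + 1" "card Q = s + 1"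
        and R: "R = {c} \<times> P \<union> {c'} \<times> Q"
      from * have "P \<noteq> {}" "Q \<noteq> {}" by auto
      with R have DR: "Domain R = {c, c'}" "Range R = P \<union> Q" by auto
      have "{c, c'} \<inter> (P \<union> Q) = {}" using disj unfolding DR .
      from bigraph_iso_H2I[OF * _ this] R DR have "bigraph_iso (Domain R, Range R, edges_of R) (H2 (2 * (s + 1)))"
        by simp
      with n have ?H2 by blast
      then show ?thesis by blast
    next
      fix c c' P Q
      assume *: "c \<noteq> c'" "P \<inter> Q = {}" "card P = s + 1" "card Q = s + 1"
        and R: "R = P \<times> {c} \<union> Q \<times> {c'}"
      from * have "P \<noteq> {}" "Q \<noteq> {}" by auto
      with R have DR: "Range R = {c, c'}" "Domain R = P \<union> Q" by auto
      have d: "{c, c'} \<inter> (P \<union> Q) = {}" using disj unfolding DR by auto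
      have "{c} \<times> P \<union> {c'} \<times> Q = R\<inverse>" unfolding R by auto
      with bigraph_iso_H2I[OF * _ d] DR have "bigraph_iso (Range R, Domain R, edges_of R) (H2 (2 * (s + 1)))"
        by simp
      from bigraph_iso_swap[OF this] n have ?H2 by blast
      then show ?thesis by blast
    next
      fix c c' P Q
      assume *: "c \<notin> Q" "c' \<notin> P" "card P = s + 1" "card Q = s + 1"
        and R: "R = {c} \<times> P \<union> Q \<times> {c'}"
      from * have "P \<noteq> {}" "Q \<noteq> {}" by auto
      with R have DR: "Domain R = {c} \<union> Q" "Range R = P \<union> {c'}" by auto
      have "insert c Q \<inter> insert c' P = {}" using disj unfolding DR by auto
      from bigraph_iso_H3I[OF * _ this] R DR have "bigraph_iso (Domain R, Range R, edges_of R) (H3 (2 * (s + 1)))"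
        by simp
      with n have ?H3 by blast
      then show ?thesis by blast
    qed
  qed
next
  case False
  then have m: "card R \<le> 2 * s + 1" by simp
  show ?thesis
  proof (rule few_edges_bound(2)[OF fin s m ex eq, THEN disjE])
    assume "\<exists>a b a' b'. a \<noteq> a' \<and> b \<noteq> b' \<and> R = {a, a'} \<times> {b, b'}"
    then obtain a b a' b' where ab: "a \<noteq> a'" "b \<noteq> b'" and R: "R = {a, a'} \<times> {b, b'}" by blast
    then have DR: "Domain R = {a, a'}" "Range R = {b, b'}" by auto
    have "{a, a'} \<inter> {b, b'} = {}" using disj unfolding DR .
    from bigraph_iso_completeI[OF _ _ this] ab R DR have ?K22 by (simp add: numeral_2_eq_2)
    then show ?thesis by blast
  next
    assume "card R = 2 * s + 1 \<and> (\<forall>a b a' b'. (a, b) \<in> R \<longrightarrow> (a', b') \<in> R \<longrightarrow> a \<noteq> a' \<longrightarrow> b \<noteq> b' \<longrightarrow>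
          (a, b') \<in> R \<longleftrightarrow> (a', b) \<notin> R)"
    note H = this
    note m = conjunct1[OF H]
    have link: "(a, b') \<in> R \<longleftrightarrow> (a', b) \<notin> R"
      if "(a, b) \<in> R" "(a', b') \<in> R" "a \<noteq> a'" "b \<noteq> b'" for a b a' b'
      by (rule conjunct2[OF H, rule_format, OF that])
    obtain a b where ab: "a \<in> Domain R" "b \<in> Range R" and R: "R = {a} \<times> Range R \<union> Domain R \<times> {b}"
      and c: "card (Domain R) = s + 1" "card (Range R) = s + 1" "1 \<le> s"
      by (rule double_star_structure[OF fin s m ex link])
    have "bigraph_iso (Domain R, Range R, edges_of R) (H4 (2 * (s + 1) - 1))"
      using bigraph_iso_H4I[OF finite_Domain[OF fin] finite_Range[OF fin] disj ab c(1,2)]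
      unfolding R[symmetric] .
    moreover have "3 \<le> 2 * (s + 1) - 1" "odd (2 * (s + 1) - 1)" using c(3) by simp_all
    ultimately have ?H4 by blast
    then show ?thesis by blast
  qed
qed

theorem theorem1p6:
  fixes V A B :: "'a set" and E :: "'a set set"
  assumes "simple_graph V E" and "finite V" and "V \<noteq> {}"
    and "bipartition V E A B"
    and "no_isolated_vertices V E"
    and "\<not> star_graph V E"
  shows "real (Min ((\<lambda>e. card (S1 E e)) ` E)) \<le> real (card E) - real (card V) / 2 \<and>
    (real (Min ((\<lambda>e. card (S1 E e)) ` E)) = real (card E) - real (card V) / 2 \<longleftrightarrow>
      bigraph_iso (A, B, E) (complete_bipartite 2 2) \<or>
      (\<exists>n\<ge>2. bigraph_iso (A, B, E) (H1 n)) \<or>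
      (\<exists>n\<ge>2. even n \<and> bigraph_iso (A, B, E) (H2 n)) \<or>
      (\<exists>n\<ge>2. even n \<and> bigraph_iso (A, B, E) (H3 n)) \<or>
      (\<exists>n\<ge>3. odd n \<and> bigraph_iso (A, B, E) (H4 n)))"
    (is "real ?s \<le> _ \<and> (_ \<longleftrightarrow> ?extremal)")
proof -
  define R where "R = {(x, y) \<in> A \<times> B. {x, y} \<in> E}"
  have V: "V = A \<union> B" and AB: "A \<inter> B = {}"
    and bip: "\<And>e. e \<in> E \<Longrightarrow> \<exists>a\<in>A. \<exists>b\<in>B. e = {a, b}"
    using assms(4) by (auto simp: bipartition_def)
  have finAB: "finite A" "finite B" using assms(2) V by auto
  have fin: "finite R"
    by (rule finite_subset[of _ "A \<times> B"]) (use finAB in \<open>auto simp: R_def\<close>)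
  have E: "E = edges_of R"
  proof
    show "E \<subseteq> edges_of R"
    proof
      fix e assume "e \<in> E"
      with bip obtain a b where "a \<in> A" "b \<in> B" "e = {a, b}" by blast
      with \<open>e \<in> E\<close> have "(a, b) \<in> R" by (simp add: R_def)
      with \<open>e = {a, b}\<close> show "e \<in> edges_of R" by (force simp: edges_of_def)
    qed
  qed (auto simp: edges_of_def R_def)
  have "\<exists>e\<in>E. v \<in> e" if "v \<in> A \<union> B" for v
    using assms(5) that V by (auto simp: no_isolated_vertices_def)
  then have inc: "\<exists>(x, y)\<in>R. v = x \<or> v = y" if "v \<in> A \<union> B" for v
    using that unfolding E edges_of_def by fastforce
  have A: "A = Domain R"
  proof
    show "A \<subseteq> Domain R" using inc AB by (fastforce simp: R_def)
  qed (auto simp: R_def)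
  have B: "B = Range R"
  proof
    show "B \<subseteq> Range R" using inc AB by (fastforce simp: R_def)
  qed (auto simp: R_def)
  have disj: "Domain R \<inter> Range R = {}" using AB A B by simp
  have sub: "R \<subseteq> Domain R \<times> Range R" by auto
  have "R \<noteq> {}" using assms(3) V A B by auto
  with star_graphI[OF fin disj] assms(6) obtain a b a' b'
    where ex: "(a, b) \<in> R" "(a', b') \<in> R" "a \<noteq> a'" "b \<noteq> b'"
    unfolding V E A B by blast
  have finE: "finite E" unfolding E edges_of_def using fin by simp
  have "E \<noteq> {}" unfolding E edges_of_def using ex by auto
  have s_le: "?s \<le> card (S1 E e)" if "e \<in> E" for e
    using finE that by simp
  have s: "?s + 2 \<le> deg R x + deg (R\<inverse>) y" if "(x, y) \<in> R" for x y
  proof -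
    have "{x, y} \<in> E" using that by (simp add: R_def)
    with s_le card_S1_edges_of[OF fin sub disj that] show ?thesis unfolding E by fastforce
  qed
  have cV: "card V = card (Domain R) + card (Range R)"
    unfolding V using finAB AB A B by (simp add: card_Un_disjoint)
  have cE: "card E = card R" unfolding E by (rule card_edges_of[OF sub disj])
  have le: "2 * ?s + card (Domain R) + card (Range R) \<le> 2 * card R"
  proof (cases "2 * ?s + 2 \<le> card R \<or> ?s = 0")
    case True
    show ?thesis by (rule many_edges_bound(1)[OF fin s True])
  next
    case False
    then have m: "card R \<le> 2 * ?s + 1" by linarith
    show ?thesis by (rule few_edges_bound(1)[OF fin s m ex])
  qed
  have ext: "?extremal" if "2 * ?s + card (Domain R) + card (Range R) = 2 * card R"
    using tight_imp_extremal_graph[OF fin disj s ex that] unfolding A[symmetric] B[symmetric] E[symmetric] .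
  have ge: "2 * card E \<le> 2 * ?s + card V" if ?extremal
  proof -
    obtain e where e: "e \<in> E" "?s = card (S1 E e)"
      using Min_in[of "(\<lambda>e. card (S1 E e)) ` E"] finE \<open>E \<noteq> {}\<close> by (auto simp del: Min_in)
    have "\<Union>E \<subseteq> A \<union> B" using bip by blast
    from extremal_graphs_tight[OF that this e(1)] show ?thesis unfolding e(2) V .
  qed
  have eq_iff: "real ?s = real (card E) - real (card V) / 2 \<longleftrightarrow>
      2 * ?s + card (Domain R) + card (Range R) = 2 * card R"
  proof -
    have "real ?s = real (card E) - real (card V) / 2 \<longleftrightarrow>
        real (2 * ?s + card (Domain R) + card (Range R)) = real (2 * card R)"
      unfolding cV cE by (auto simp: field_simps)
    then show ?thesis by (simp only: of_nat_eq_iff)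
  qed
  show ?thesis
  proof (intro conjI iffI)
    show "real ?s \<le> real (card E) - real (card V) / 2"
      using le unfolding cV cE by (simp add: field_simps flip: of_nat_add of_nat_mult)
    show ?extremal if "real ?s = real (card E) - real (card V) / 2"
      by (rule ext[OF iffD1[OF eq_iff that]])
    assume ?extremal
    from ge[OF this] le cV cE have "2 * ?s + card (Domain R) + card (Range R) = 2 * card R"
      by linarith
    then show "real ?s = real (card E) - real (card V) / 2" by (rule iffD2[OF eq_iff])
  qed
qed

end
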